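(* Let $d\ge 7$ be an integer with $d\equiv 3\pmod 4$, put $d'=\lfloor d/4\rfloor$, let $k$ be a rational and $\varepsilon$ a positive real such that $$2\le k<2+\frac{1}{2d'}\qquad\text{and}\qquad \varepsilon+\varepsilon k\sum_{j=0}^{d'-1}(k-1)^{2j+1}\ \ge\ 1.$$ If $G$ is a fractionally $k$-colorable graph and $W\subseteq V(G)$ is a set of vertices at pairwise distance at least $d$, then every fractional $(k+\varepsilon)$-precoloring of $W$ extends to a fractional $(k+\varepsilon)$-coloring of $G$.
   Context: A fractional $m$-coloring of a graph (real $m>0$) assigns to each vertex a measurable subset of $[0,m)$ of Lebesgue measure one so that adjacent vertices receive disjoint sets; a graph is fractionally $k$-colorable if it has a fractional $k$-coloring. A fractional $m$-precoloring of a vertex set $W$ assigns measurable subsets of $[0,m)$ of measure one to the vertices of $W$; it extends if some fractional $m$-coloring of the whole graph agrees with it on $W$. Graphs are finite. *)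

theory Defs
  imports "HOL-Analysis.Analysis"
begin

definition simple_graph :: "'a set \<Rightarrow> ('a \<Rightarrow> 'a \<Rightarrow> bool) \<Rightarrow> bool" where
  "simple_graph V E \<longleftrightarrow> finite V \<and> (\<forall>u v. E u v \<longrightarrow> u \<in> V \<and> v \<in> V)
     \<and> (\<forall>u v. E u v \<longrightarrow> E v u) \<and> (\<forall>v. \<not> E v v)"

definition unit_color_set :: "real \<Rightarrow> real set \<Rightarrow> bool" where
  "unit_color_set m S \<longleftrightarrow> S \<in> sets lebesgue \<and> S \<subseteq> {0..<m} \<and> emeasure lebesgue S = 1"

definition frac_coloring :: "'a set \<Rightarrow> ('a \<Rightarrow> 'a \<Rightarrow> bool) \<Rightarrow> real \<Rightarrow> ('a \<Rightarrow> real set) \<Rightarrow> bool" where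
  "frac_coloring V E m c \<longleftrightarrow> (\<forall>v\<in>V. unit_color_set m (c v))
     \<and> (\<forall>u\<in>V. \<forall>v\<in>V. E u v \<longrightarrow> c u \<inter> c v = {})"

definition frac_colorable :: "'a set \<Rightarrow> ('a \<Rightarrow> 'a \<Rightarrow> bool) \<Rightarrow> real \<Rightarrow> bool" where
  "frac_colorable V E k \<longleftrightarrow> (\<exists>c. frac_coloring V E k c)"

definition frac_precoloring :: "'a set \<Rightarrow> real \<Rightarrow> ('a \<Rightarrow> real set) \<Rightarrow> bool" where
  "frac_precoloring W m f \<longleftrightarrow> (\<forall>w\<in>W. unit_color_set m (f w))"

definition precoloring_extends :: "'a set \<Rightarrow> ('a \<Rightarrow> 'a \<Rightarrow> bool) \<Rightarrow> real \<Rightarrow> 'a set \<Rightarrow> ('a \<Rightarrow> real set) \<Rightarrow> bool" where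
  "precoloring_extends V E m W f \<longleftrightarrow> (\<exists>c. frac_coloring V E m c \<and> (\<forall>w\<in>W. c w = f w))"

definition walk_len :: "('a \<Rightarrow> 'a \<Rightarrow> bool) \<Rightarrow> nat \<Rightarrow> 'a \<Rightarrow> 'a \<Rightarrow> bool" where
  "walk_len E n u v \<longleftrightarrow> (\<exists>xs. length xs = Suc n \<and> xs ! 0 = u \<and> xs ! n = v
      \<and> (\<forall>i<n. E (xs ! i) (xs ! Suc i)))"

text \<open>Distance between u and v is at least d (infinite distance allowed).\<close>
definition dist_ge :: "('a \<Rightarrow> 'a \<Rightarrow> bool) \<Rightarrow> nat \<Rightarrow> 'a \<Rightarrow> 'a \<Rightarrow> bool" where
  "dist_ge E d u v \<longleftrightarrow> (\<forall>n<d. \<not> walk_len E n u v)"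

end

theory Submission
  imports Defs
begin

text \<open>A fractional $k$-coloring is a random independent set $X$ containing every vertex with
  probability $1/k$. Put $D = \lfloor d/4 \rfloor$ and $m = k + \varepsilon$, and label the points of
  $[0,m)$ by triples $(X, s, r)$ that are independent of every set $f(w)$, with $X$ as above and
  random thresholds $s, r \le D$. Away from $W$, a vertex takes the points whose $X$ contains it; this
  has measure $m/k > 1$. The balls of radius $2D+1$ around $W$ are disjoint and, since $k < 2 + 1/(2D)$
  excludes odd closed walks of length at most $4D+1$, their layers up to $2D$ are independent sets.
  In such a ball, a point of $f(w)$ is given to all even layers up to $2r$ and follows $X$ only from
  layer $2r+2$ on; a point outside $f(w)$ is given to all odd layers below $2s$ and follows $X$ only
  from layer $2s+1$ on. Every layer receives measure at least one if the tails
  $b_j = P(r \ge j)$ and $a_j = (m-1) P(s \ge j)$ satisfy $a_j = \varepsilon + (k-1) b_j$,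
  $b_j \le \varepsilon + (k-1) a_{j+1}$ and $b_D \le \varepsilon$. Solving this recursion downwards
  from $j = D$ allows $b_0 = 1$ exactly under the hypothesis on $\varepsilon$.\<close>

section \<open>Lebesgue measure: subsets of prescribed measure and independent labels\<close>

lemma measure_Un_disjoint:
  "A \<in> fmeasurable M \<Longrightarrow> B \<in> fmeasurable M \<Longrightarrow> A \<inter> B = {} \<Longrightarrow> measure M (A \<union> B) = measure M A + measure M B"
  by (simp add: measure_Un3)

text \<open>The measure of \<open>B \<inter> {..y}\<close> is a 1-Lipschitz function of
  \<open>y\<close>, so the intermediate value theorem yields a cut at which it equals
  \<open>t\<close>.\<close>

lemma lebesgue_subset_of_measure:
  fixes B :: "real set"
  assumes B: "B \<in> sets lebesgue" "B \<subseteq> {a..b}" and t: "0 \<le> t" "t \<le> measure lebesgue B"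
  shows "\<exists>A\<subseteq>B. A \<in> sets lebesgue \<and> measure lebesgue A = t"
proof (cases "a \<le> b")
  case False
  then have "B = {}" using B by auto
  then show ?thesis using t by auto
next
  case True
  have fin: "S \<in> lmeasurable" if "S \<in> sets lebesgue" "S \<subseteq> {a..b}" for S
    using bounded_set_imp_lmeasurable[OF bounded_subset[OF bounded_closed_interval]] that by blast
  define h where "h = (\<lambda>y. measure lebesgue (B \<inter> {..y}))"
  have meas: "B \<inter> {..y} \<in> lmeasurable" for y
    using B by (intro fin) auto
  have step: "h x \<le> h y \<and> h y \<le> h x + (y - x)" if "x \<le> y" for x y
  proof
    show "h x \<le> h y"
      unfolding h_def using meas that by (intro measure_mono_fmeasurable) (auto intro: fmeasurableD)
    have "h y \<le> measure lebesgue ((B \<inter> {..x}) \<union> {x..y})"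
      unfolding h_def using meas
      by (intro measure_mono_fmeasurable) (auto intro: fmeasurableD)
    also have "\<dots> \<le> h x + measure lebesgue {x..y}"
      unfolding h_def using meas[of x] by (intro measure_Un_le) (auto intro: fmeasurableD)
    finally show "h y \<le> h x + (y - x)" using that by simp
  qed
  have "1-lipschitz_on {a..b} h"
  proof (rule lipschitz_onI)
    fix x y show "dist (h x) (h y) \<le> 1 * dist x y"
      using step[of x y] step[of y x] by (cases "x \<le> y") (auto simp: dist_real_def)
  qed simp
  then have cont: "continuous_on {a..b} h" by (rule lipschitz_on_continuous_on)
  have "h a \<le> measure lebesgue {a}"
    unfolding h_def using meas B fin[of "{a}"] True by (intro measure_mono_fmeasurable) (auto intro: fmeasurableD)
  then have ha: "h a \<le> t" using t by simp
  have "B \<inter> {..b} = B" using B by auto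
  then have hb: "t \<le> h b" using t by (simp add: h_def)
  obtain y where "h y = t" using IVT'[OF ha hb True cont] by blast
  then show ?thesis using meas[of y] unfolding h_def by (intro exI[of _ "B \<inter> {..y}"]) (auto intro: fmeasurableD)
qed

text \<open>Pieces of the required measures are cut off one at a time; the last label takes what
  remains. The labelling has values in \<open>N\<close> off \<open>B\<close> as well, so that
  labellings of different sets can be glued.\<close>

lemma lebesgue_partition_of_measures:
  fixes B :: "real set" and q :: "'n \<Rightarrow> real"
  assumes "finite N" "N \<noteq> {}" "\<And>n. n \<in> N \<Longrightarrow> 0 \<le> q n"
    "B \<in> sets lebesgue" "B \<subseteq> {a..b}" "measure lebesgue B = sum q N"
  shows "\<exists>g. (\<forall>x. g x \<in> N) \<and> (\<forall>n\<in>N. {x\<in>B. g x = n} \<in> sets lebesgue \<and> measure lebesgue {x\<in>B. g x = n} = q n)"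
  using assms
proof (induction N arbitrary: B rule: finite_ne_induct)
  case (singleton n)
  then show ?case by (intro exI[of _ "\<lambda>_. n"]) auto
next
  case (insert n N)
  have "q n \<le> measure lebesgue B"
    using insert by (simp add: sum_nonneg)
  with lebesgue_subset_of_measure[OF insert.prems(2,3), of "q n"] insert.prems(1)
  obtain A where A: "A \<subseteq> B" "A \<in> sets lebesgue" "measure lebesgue A = q n" by auto
  have BA: "B - A \<in> sets lebesgue" "B - A \<subseteq> {a..b}" using A insert.prems by auto
  have "B \<in> lmeasurable"
    using bounded_set_imp_lmeasurable[OF bounded_subset[OF bounded_closed_interval]] insert.prems by blast
  then have "measure lebesgue (B - A) = sum q N"
    using A insert by (simp add: measurable_measure_Diff)
  with insert.IH[OF _ BA] insert.prems(1)
  obtain g where g: "\<forall>x. g x \<in> N"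
    "\<forall>n\<in>N. {x\<in>B-A. g x = n} \<in> sets lebesgue \<and> measure lebesgue {x\<in>B-A. g x = n} = q n" by auto
  define g' where "g' = (\<lambda>x. if x \<in> A then n else g x)"
  have "{x\<in>B. g' x = n} = A" using A g(1) insert.hyps by (auto simp: g'_def)
  moreover have "{x\<in>B. g' x = n'} = {x\<in>B-A. g x = n'}" if "n' \<in> N" for n'
    using that insert.hyps by (auto simp: g'_def)
  ultimately show ?case
    using g A by (intro exI[of _ g']) (auto simp: g'_def)
qed

text \<open>Adding a set \<open>S\<close> to \<open>F\<close> splits \<open>B\<close> into
  \<open>B \<inter> S\<close> and \<open>B - S\<close>. The induction hypothesis labels each half in
  the right proportions, both overall and inside every older \<open>T\<close>; gluing keeps the old
  proportions by additivity and gives the new one on \<open>S\<close>. This is why the induction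
  varies \<open>B\<close>.\<close>

lemma lebesgue_independent_labelling:
  fixes B :: "real set" and p :: "'n \<Rightarrow> real"
  assumes "finite F" "F \<subseteq> sets lebesgue" "B \<in> sets lebesgue" "B \<subseteq> {a..b}"
    and N: "finite N" "\<And>n. n \<in> N \<Longrightarrow> 0 \<le> p n" "sum p N = 1"
  shows "\<exists>g. (\<forall>x. g x \<in> N) \<and> (\<forall>n\<in>N. {x\<in>B. g x = n} \<in> sets lebesgue \<and>
    measure lebesgue {x\<in>B. g x = n} = p n * measure lebesgue B \<and>
    (\<forall>S\<in>F. measure lebesgue {x\<in>B \<inter> S. g x = n} = p n * measure lebesgue (B \<inter> S)))"
  using assms(1-4)
proof (induction F arbitrary: B rule: finite_induct)
  case empty
  have "N \<noteq> {}" using N by auto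
  from lebesgue_partition_of_measures[of N "\<lambda>n. p n * measure lebesgue B" B a b] N this empty
  show ?case by (auto simp: sum_distrib_right[symmetric])
next
  case (insert S F)
  have S: "S \<in> sets lebesgue" and F: "F \<subseteq> sets lebesgue" using insert.prems by auto
  have lm: "C \<in> lmeasurable" if "C \<in> sets lebesgue" "C \<subseteq> B" for C
    using bounded_set_imp_lmeasurable[OF bounded_subset[OF bounded_closed_interval]] that insert.prems by blast
  have add: "measure lebesgue C = measure lebesgue (C \<inter> S) + measure lebesgue (C - S)"
    if "C \<in> sets lebesgue" "C \<subseteq> B" for C
  proof -
    have "C \<inter> S \<in> lmeasurable" "C - S \<in> lmeasurable"
      using that S by (auto intro!: lm)
    then have "measure lebesgue ((C \<inter> S) \<union> (C - S)) = measure lebesgue (C \<inter> S) + measure lebesgue (C - S)"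
      by (intro measure_Un_disjoint) auto
    then show ?thesis by (simp add: Int_Diff_Un)
  qed
  have "B \<inter> S \<in> sets lebesgue" "B \<inter> S \<subseteq> {a..b}" using insert.prems S by auto
  from insert.IH[OF F this]
  obtain g1 where g1: "\<forall>x. g1 x \<in> N" "\<forall>n\<in>N. {x\<in>B \<inter> S. g1 x = n} \<in> sets lebesgue \<and>
    measure lebesgue {x\<in>B \<inter> S. g1 x = n} = p n * measure lebesgue (B \<inter> S) \<and>
    (\<forall>T\<in>F. measure lebesgue {x\<in>(B \<inter> S) \<inter> T. g1 x = n} = p n * measure lebesgue ((B \<inter> S) \<inter> T))"
    by (elim exE conjE) (rule that)
  have "B - S \<in> sets lebesgue" "B - S \<subseteq> {a..b}" using insert.prems S by auto
  from insert.IH[OF F this]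
  obtain g2 where g2: "\<forall>x. g2 x \<in> N" "\<forall>n\<in>N. {x\<in>B - S. g2 x = n} \<in> sets lebesgue \<and>
    measure lebesgue {x\<in>B - S. g2 x = n} = p n * measure lebesgue (B - S) \<and>
    (\<forall>T\<in>F. measure lebesgue {x\<in>(B - S) \<inter> T. g2 x = n} = p n * measure lebesgue ((B - S) \<inter> T))"
    by (elim exE conjE) (rule that)
  define g where "g = (\<lambda>x. if x \<in> S then g1 x else g2 x)"
  have un: "{x\<in>B. g x = n} = {x\<in>B \<inter> S. g1 x = n} \<union> {x\<in>B - S. g2 x = n}" for n
    by (auto simp: g_def)
  have m: "{x\<in>B. g x = n} \<in> sets lebesgue" if "n \<in> N" for n
    unfolding un using g1(2)[rule_format, OF that] g2(2)[rule_format, OF that] by blast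
  \<comment> \<open>Proportions on the two halves add up; \<open>T = UNIV\<close> later gives the
    proportion on all of \<open>B\<close>.\<close>
  have gen: "measure lebesgue {x\<in>B \<inter> T. g x = n} = p n * measure lebesgue (B \<inter> T)"
    if n: "n \<in> N" and T: "T \<in> sets lebesgue"
      and 1: "measure lebesgue {x\<in>(B \<inter> S) \<inter> T. g1 x = n} = p n * measure lebesgue ((B \<inter> S) \<inter> T)"
      and 2: "measure lebesgue {x\<in>(B - S) \<inter> T. g2 x = n} = p n * measure lebesgue ((B - S) \<inter> T)" for T n
  proof -
    have "{x\<in>B \<inter> T. g x = n} = {x\<in>B. g x = n} \<inter> T" by auto
    then have "{x\<in>B \<inter> T. g x = n} \<in> sets lebesgue" using m[OF n] T by auto
    moreover have "{x\<in>B \<inter> T. g x = n} \<inter> S = {x\<in>(B \<inter> S) \<inter> T. g1 x = n}"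
      "{x\<in>B \<inter> T. g x = n} - S = {x\<in>(B - S) \<inter> T. g2 x = n}"
      "(B \<inter> T) \<inter> S = (B \<inter> S) \<inter> T" "(B \<inter> T) - S = (B - S) \<inter> T"
      by (auto simp: g_def)
    ultimately show ?thesis
      using add[of "{x\<in>B \<inter> T. g x = n}"] add[of "B \<inter> T"] 1 2 T insert.prems
      by (auto simp: distrib_left)
  qed
  have "\<forall>x. g x \<in> N" using g1 g2 by (simp add: g_def)
  moreover have "measure lebesgue {x\<in>B. g x = n} = p n * measure lebesgue B" if "n \<in> N" for n
    using gen[of n UNIV] g1(2)[rule_format, OF that] g2(2)[rule_format, OF that] that by simp
  moreover have "measure lebesgue {x\<in>B \<inter> T. g x = n} = p n * measure lebesgue (B \<inter> T)"
    if "n \<in> N" "T \<in> insert S F" for n T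
  proof (cases "T = S")
    case True
    have "(B \<inter> S) \<inter> S = B \<inter> S" "(B - S) \<inter> S = {}" by auto
    moreover have "{x \<in> {}. g2 x = n} = {}" by simp
    ultimately show ?thesis
      using gen[OF that(1) S] g1(2)[rule_format, OF that(1)] by (simp only: True measure_empty mult_zero_right)
  next
    case False
    then show ?thesis
      using gen[OF that(1), of T] g1(2)[rule_format, OF that(1)] g2(2)[rule_format, OF that(1)] that F by auto
  qed
  ultimately show ?case using m by (intro exI[of _ g]) blast
qed

text \<open>Passes from single labels to arbitrary events \<open>P\<close> by finite additivity:
  inside \<open>T\<close> the label behaves like a random variable with distribution
  \<open>p\<close>.\<close>

lemma measure_label_event:
  fixes B :: "real set"
  assumes B: "B \<in> lmeasurable" and T: "T \<in> sets lebesgue" and N: "finite N" "\<And>x. x \<in> B \<Longrightarrow> g x \<in> N"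
    and m: "\<And>n. n \<in> N \<Longrightarrow> {x\<in>B. g x = n} \<in> sets lebesgue"
    and p: "\<And>n. n \<in> N \<Longrightarrow> measure lebesgue {x\<in>B \<inter> T. g x = n} = p n * measure lebesgue (B \<inter> T)"
  shows "{x\<in>B \<inter> T. P (g x)} \<in> sets lebesgue"
    and "measure lebesgue {x\<in>B \<inter> T. P (g x)} = measure lebesgue (B \<inter> T) * sum p {n\<in>N. P n}"
proof -
  have eq: "{x\<in>B \<inter> T. P (g x)} = (\<Union>n\<in>{n\<in>N. P n}. {x\<in>B \<inter> T. g x = n})" using N by auto
  have "{x\<in>B \<inter> T. g x = n} = {x\<in>B. g x = n} \<inter> T" for n by auto
  then have m': "{x\<in>B \<inter> T. g x = n} \<in> sets lebesgue" if "n \<in> N" for n using m[OF that] T by auto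
  show "{x\<in>B \<inter> T. P (g x)} \<in> sets lebesgue" unfolding eq using m' N by auto
  have "{x\<in>B \<inter> T. g x = n} \<in> lmeasurable" if "n \<in> N" for n
    using m'[OF that] B by (intro fmeasurableI2[OF B]) auto
  then have "measure lebesgue {x\<in>B \<inter> T. P (g x)} = (\<Sum>n\<in>{n\<in>N. P n}. measure lebesgue {x\<in>B \<inter> T. g x = n})"
    unfolding eq using N by (intro measure_UNION_AE[THEN trans] ) (auto simp: pairwise_def)
  also have "\<dots> = measure lebesgue (B \<inter> T) * sum p {n\<in>N. P n}"
    unfolding sum_distrib_left by (intro sum.cong refl) (simp add: p mult.commute del: Int_iff)
  finally show "measure lebesgue {x\<in>B \<inter> T. P (g x)} = measure lebesgue (B \<inter> T) * sum p {n\<in>N. P n}" .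
qed

section \<open>Walks as relational powers, and short odd closed walks\<close>

lemma walk_len_eq_relpowp: "walk_len E n u v \<longleftrightarrow> (E ^^ n) u v"
proof
  assume "walk_len E n u v"
  then obtain xs where "length xs = Suc n" "xs ! 0 = u" "xs ! n = v" "\<forall>i<n. E (xs ! i) (xs ! Suc i)"
    unfolding walk_len_def by blast
  then show "(E ^^ n) u v" unfolding relpowp_fun_conv by (intro exI[of _ "(!) xs"]) auto
next
  assume "(E ^^ n) u v"
  then obtain h where "h 0 = u" "h n = v" "\<forall>i<n. E (h i) (h (Suc i))"
    unfolding relpowp_fun_conv by blast
  then show "walk_len E n u v" unfolding walk_len_def
    by (intro exI[of _ "map h [0..<Suc n]"]) (auto simp del: upt_Suc)
qed

lemma relpowp_sym:
  assumes "\<And>u v. E u v \<Longrightarrow> E v u"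
  shows "(E ^^ n) u v \<Longrightarrow> (E ^^ n) v u"
proof (induction n arbitrary: v)
  case (Suc n)
  then show ?case by (metis assms relpowp_Suc_E relpowp_Suc_I2)
qed simp

lemma relpowp_trans: "(E ^^ m) u v \<Longrightarrow> (E ^^ n) v w \<Longrightarrow> (E ^^ (m + n)) u w"
  by (auto simp: relpowp_add)

lemma unit_color_set_lmeasurable:
  "unit_color_set m S \<Longrightarrow> S \<in> lmeasurable" "unit_color_set m S \<Longrightarrow> measure lebesgue S = 1"
  by (auto simp: unit_color_set_def fmeasurable_def measure_def)

text \<open>Two steps \<open>x\<close>, \<open>y\<close>, \<open>v\<close> change the color set
  little: \<open>c x\<close>, \<open>c y\<close> and \<open>c v - c x\<close> are pairwise disjoint
  in \<open>{0..<k}\<close>, and the first two have measure one, which leaves at most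
  \<open>k - 2\<close> for the third. These changes add up along the walk.\<close>

lemma frac_coloring_even_walk:
  assumes G: "simple_graph V E" and c: "frac_coloring V E k c" and "u \<in> V"
  shows "(E ^^ (2 * i)) u v \<Longrightarrow> v \<in> V \<and> measure lebesgue (c v - c u) \<le> real i * (k - 2)"
proof (induction i arbitrary: v)
  case 0
  then show ?case using \<open>u \<in> V\<close> by simp
next
  case (Suc i)
  then obtain x y where w: "(E ^^ (2 * i)) u x" "E x y" "E y v"
    by (auto elim!: relpowp_Suc_E)
  have V: "x \<in> V" "y \<in> V" "v \<in> V" using w G by (auto simp: simple_graph_def)
  then have un: "unit_color_set k (c x)" "unit_color_set k (c y)" "unit_color_set k (c v)" "unit_color_set k (c u)"
    using c \<open>u \<in> V\<close> by (auto simp: frac_coloring_def)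
  note lm = un[THEN unit_color_set_lmeasurable(1)] and m1 = un[THEN unit_color_set_lmeasurable(2)]
  have disj: "c x \<inter> c y = {}" "c v \<inter> c y = {}"
    using w V c G by (auto simp: frac_coloring_def simple_graph_def)
  have "(c v - c x) \<union> (c x \<union> c y) \<subseteq> {0..<k}" using un by (auto simp: unit_color_set_def)
  moreover have "{0..<k} \<in> lmeasurable" by (rule bounded_set_imp_lmeasurable) auto
  ultimately have "measure lebesgue ((c v - c x) \<union> (c x \<union> c y)) \<le> measure lebesgue {0..<k}"
    using lm by (intro measure_mono_fmeasurable) (auto intro!: fmeasurableD)
  moreover have "0 \<le> k"
    using m1(1) un(1) by (cases "0 \<le> k") (auto simp: unit_color_set_def)
  moreover have "measure lebesgue ((c v - c x) \<union> (c x \<union> c y)) = measure lebesgue (c v - c x) + 2"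
    using lm disj m1 by (subst measure_Un_disjoint) (auto simp: measure_Un_disjoint)
  ultimately have a: "measure lebesgue (c v - c x) \<le> k - 2" by simp
  have "measure lebesgue (c v - c u) \<le> measure lebesgue ((c v - c x) \<union> (c x - c u))"
    using lm by (intro measure_mono_fmeasurable) (auto intro!: fmeasurableD fmeasurable.Un fmeasurable_Diff)
  also have "\<dots> \<le> measure lebesgue (c v - c x) + measure lebesgue (c x - c u)"
    using lm by (intro measure_Un_le) (auto intro!: fmeasurableD fmeasurable_Diff)
  also have "\<dots> \<le> (k - 2) + real i * (k - 2)" using a Suc.IH[OF w(1)] by simp
  finally show ?case using V by (simp add: algebra_simps)
qed

text \<open>The last edge of such a walk would make the color sets of its ends disjoint, a change of
  measure one, whereas the preceding \<open>2 * i\<close> steps allow only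
  \<open>i * (k - 2) < 1\<close>.\<close>

lemma frac_coloring_no_short_odd_closed_walk:
  assumes G: "simple_graph V E" and c: "frac_coloring V E k c" and "u \<in> V"
    and k: "2 \<le> k" "k < 2 + 1 / real L" and "i \<le> L"
  shows "\<not> (E ^^ (2 * i + 1)) u u"
proof
  assume "(E ^^ (2 * i + 1)) u u"
  then obtain v where v: "(E ^^ (2 * i)) u v" "E v u" by (auto elim!: relpowp_Suc_E)
  from frac_coloring_even_walk[OF G c \<open>u \<in> V\<close> v(1)]
  have m: "v \<in> V" "measure lebesgue (c v - c u) \<le> real i * (k - 2)" by auto
  have "c v - c u = c v" using v m c \<open>u \<in> V\<close> by (auto simp: frac_coloring_def)
  then have "1 \<le> real i * (k - 2)"
    using m c unit_color_set_lmeasurable(2)[of k "c v"] by (auto simp: frac_coloring_def)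
  also have "\<dots> \<le> real L * (k - 2)" using k \<open>i \<le> L\<close> by (intro mult_right_mono) auto
  finally show False using k by (cases "L = 0") (auto simp: field_simps)
qed

section \<open>Tail probabilities of the thresholds\<close>

lemma threshold_sequence:
  fixes k \<epsilon> :: real
  assumes k: "2 \<le> k" and e: "\<epsilon> > 0" and "\<epsilon> + \<epsilon> * k * (\<Sum>j<D. (k - 1) ^ (2 * j + 1)) \<ge> 1"
  obtains b :: "nat \<Rightarrow> real" where "b 0 = 1" "\<And>j. 0 \<le> b j" "\<And>j. b (Suc j) \<le> b j" "b D \<le> \<epsilon>"
    "\<And>j. j < D \<Longrightarrow> b j \<le> \<epsilon> + (k - 1) * (\<epsilon> + (k - 1) * b (Suc j))"
proof -
  \<comment> \<open>Closed form of the recursion with equality, started at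
    \<open>B 0 = \<epsilon>\<close> and indexed from the outermost layer inwards. The hypothesis
    says \<open>B D \<ge> 1\<close>, so truncation at \<open>1\<close> gives
    \<open>b 0 = 1\<close>.\<close>
  define B where "B n = \<epsilon> + \<epsilon> * k * (\<Sum>i<n. (k - 1) ^ (2 * i + 1))" for n
  define b where "b j = min 1 (B (D - j))" for j
  have Bmono: "B n \<le> B (Suc n)" and Bpos: "0 \<le> B n" for n
    using k e by (auto simp: B_def intro!: mult_nonneg_nonneg add_nonneg_nonneg sum_nonneg)
  have BSuc: "B (Suc n) = \<epsilon> + (k - 1) * (\<epsilon> + (k - 1) * B n)" for n
  proof -
    have "(\<Sum>i<Suc n. (k - 1) ^ (2 * i + 1)) = (k - 1) + (k - 1)^2 * (\<Sum>i<n. (k - 1) ^ (2 * i + 1))"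
      by (subst sum.lessThan_Suc_shift) (simp add: sum_distrib_left power2_eq_square mult.assoc)
    then show ?thesis unfolding B_def by (simp only:) (simp add: algebra_simps power2_eq_square)
  qed
  show ?thesis
  proof
    show "b 0 = 1" using assms(3) by (simp add: b_def B_def)
    show "0 \<le> b j" for j using Bpos by (simp add: b_def)
    show "b (Suc j) \<le> b j" for j
      using Bmono[of "D - Suc j"] by (cases "j < D") (auto simp: b_def Suc_diff_Suc)
    show "b D \<le> \<epsilon>" by (simp add: b_def B_def)
    fix j assume "j < D"
    \<comment> \<open>Covers the truncated case: if \<open>b (Suc j) = 1\<close>, the right-hand
      side of the recursion is still at least \<open>1\<close>.\<close>
    have ge1: "1 \<le> \<epsilon> + (k - 1) * (\<epsilon> + (k - 1))"
    proof -
      have "1 \<le> 1 * (\<epsilon> + (k - 1))" using k e by simp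
      also have "\<dots> \<le> (k - 1) * (\<epsilon> + (k - 1))" using k e by (intro mult_right_mono) auto
      finally show ?thesis using e by simp
    qed
    show "b j \<le> \<epsilon> + (k - 1) * (\<epsilon> + (k - 1) * b (Suc j))"
      using BSuc[of "D - Suc j"] \<open>j < D\<close> ge1 by (cases "1 \<le> B (D - Suc j)") (auto simp: b_def Suc_diff_Suc)
  qed
qed


text \<open>A uniformly random color \<open>y\<close> in \<open>{0..<k}\<close> determines its color
  class \<open>h y\<close>, which is independent and contains each vertex with probability
  \<open>1 / k\<close>; \<open>q\<close> is the distribution of this class.\<close>

lemma frac_coloring_distribution:
  assumes G: "simple_graph V E" and c: "frac_coloring V E k c" and k: "0 < k"
  obtains I :: "'a set set" and q where "finite I" "\<And>X u v. X \<in> I \<Longrightarrow> u \<in> X \<Longrightarrow> v \<in> X \<Longrightarrow> \<not> E u v"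
    "\<And>X. 0 \<le> q X" "sum q I = 1" "\<And>v. v \<in> V \<Longrightarrow> sum q {X\<in>I. v \<in> X} = 1 / k"
proof
  define h where "h y = {v\<in>V. y \<in> c v}" for y
  define I where "I = h ` {0..<k}"
  define q where "q X = measure lebesgue {y\<in>{0..<k}. h y = X} / k" for X
  have "finite V" using G by (simp add: simple_graph_def)
  moreover have IV: "I \<subseteq> Pow V" by (auto simp: I_def h_def)
  ultimately show finI: "finite I" using finite_subset by blast
  have un: "unit_color_set k (c v)" if "v \<in> V" for v using c that by (auto simp: frac_coloring_def)
  have B: "{0..<k} \<in> lmeasurable" by (rule bounded_set_imp_lmeasurable) auto
  have hm: "{y\<in>{0..<k}. h y = X} \<in> sets lebesgue" if "X \<in> I" for X
  proof -
    have X: "X \<subseteq> V" using that IV by auto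
    \<comment> \<open>A finite Boolean combination of color sets, hence measurable.\<close>
    then have eq: "{y\<in>{0..<k}. h y = X} = {0..<k} - ((\<Union>v\<in>X. {0..<k} - c v) \<union> (\<Union>v\<in>V - X. c v))"
      by (auto simp: h_def)
    have "finite X" using X \<open>finite V\<close> finite_subset by blast
    moreover have "c v \<in> sets lebesgue" if "v \<in> V" for v using un[OF that] by (simp add: unit_color_set_def)
    ultimately have "(\<Union>v\<in>X. {0..<k} - c v) \<in> sets lebesgue" "(\<Union>v\<in>V - X. c v) \<in> sets lebesgue"
      using X \<open>finite V\<close> by (intro sets.finite_UN; force)+
    then show ?thesis unfolding eq by (intro sets.Diff sets.Un) auto
  qed
  have ev: "measure lebesgue {y\<in>{0..<k}. P (h y)} = k * sum q {X\<in>I. P X}" for P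
    using measure_label_event(2)[where B = "{0..<k}" and T = UNIV and N = I and g = h and p = q and P = P]
      B finI hm k by (simp add: q_def I_def)
  show "sum q I = 1"
  proof -
    have "{y\<in>{0..<k}. True} = {0..<k}" by auto
    then show ?thesis using ev[of "\<lambda>_. True"] k by simp
  qed
  show "sum q {X\<in>I. v \<in> X} = 1 / k" if "v \<in> V" for v
  proof -
    have "{y\<in>{0..<k}. v \<in> h y} = c v" using un[OF that] that by (auto simp: h_def unit_color_set_def)
    then show ?thesis
      using ev[of "\<lambda>X. v \<in> X"] unit_color_set_lmeasurable(2)[OF un[OF that]] k by (simp add: field_simps)
  qed
  show "\<not> E u v" if "X \<in> I" "u \<in> X" "v \<in> X" for X u v
    using that c by (auto simp: I_def h_def frac_coloring_def)
  show "0 \<le> q X" for X using k by (simp add: q_def)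
qed

text \<open>Whether the vertex \<open>v\<close> in layer \<open>l\<close> around \<open>w\<close> receives a point labelled \<open>(X, s, r)\<close>;
  \<open>b\<close> says whether the point lies in \<open>f w\<close>.\<close>

definition shell_member :: "bool \<Rightarrow> nat \<Rightarrow> 'a \<Rightarrow> 'a set \<times> nat \<times> nat \<Rightarrow> bool" where
  "shell_member b l v = (\<lambda>(X, s, r).
     if b then even l \<and> l \<le> 2 * r \<or> 2 * r + 2 \<le> l \<and> v \<in> X
     else odd l \<and> l < 2 * s \<or> 2 * s + 1 \<le> l \<and> v \<in> X)"

text \<open>Under \<open>p\<close> the components of a label are independent, with
  \<open>\<alpha> j\<close> and \<open>\<beta> j\<close> the tails of \<open>s\<close> and
  \<open>r\<close>. Each event is a box or a union of two disjoint boxes: one where the layer is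
  filled whatever \<open>X\<close> is, and one where membership follows \<open>X\<close> and costs
  the factor \<open>\<kappa>\<close>.\<close>

lemma shell_member_weights:
  fixes q :: "'a set \<Rightarrow> real" and \<alpha> \<beta> :: "nat \<Rightarrow> real"
  assumes I: "finite I" "sum q I = 1" and v: "sum q {X\<in>I. v \<in> X} = \<kappa>"
    and \<alpha>: "\<alpha> 0 = 1" "\<alpha> (Suc D) = 0" and \<beta>: "\<beta> 0 = 1" "\<beta> (Suc D) = 0"
  defines "p \<equiv> \<lambda>(X, s, r). q X * ((\<alpha> s - \<alpha> (Suc s)) * (\<beta> r - \<beta> (Suc r)))"
    and "N \<equiv> I \<times> {..D} \<times> {..D}"
  shows "sum p N = 1" and "sum p {n\<in>N. v \<in> fst n} = \<kappa>"
    and "j \<le> D \<Longrightarrow> sum p {n\<in>N. shell_member True (2 * j) v n} = \<beta> j + \<kappa> * (1 - \<beta> j)"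
    and "j \<le> D \<Longrightarrow> sum p {n\<in>N. shell_member True (2 * j + 1) v n} = \<kappa> * (1 - \<beta> j)"
    and "j \<le> D \<Longrightarrow> sum p {n\<in>N. shell_member False (2 * j) v n} = \<kappa> * (1 - \<alpha> j)"
    and "j \<le> D \<Longrightarrow> sum p {n\<in>N. shell_member False (2 * j + 1) v n} = \<alpha> (Suc j) + \<kappa> * (1 - \<alpha> (Suc j))"
proof -
  define A B where "A s = \<alpha> s - \<alpha> (Suc s)" and "B r = \<beta> r - \<beta> (Suc r)" for s r
  let ?J = "{X\<in>I. v \<in> X}"
  have prod: "sum p (Q \<times> S \<times> R) = sum q Q * (sum A S * sum B R)" for Q S R
    unfolding p_def A_def B_def sum_product sum.cartesian_product by (simp add: split_def)
  have lo: "sum A {..<j} = 1 - \<alpha> j" "sum B {..<j} = 1 - \<beta> j" for j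
    unfolding A_def B_def using \<alpha> \<beta> by (simp_all add: sum_lessThan_telescope')
  have full: "sum A {..D} = 1" "sum B {..D} = 1"
    using lo[of "Suc D"] \<alpha> \<beta> by (simp_all add: lessThan_Suc_atMost)
  have "{..D} = {..<j} \<union> {j..D}" "{..<j} \<inter> {j..D} = {}" if "j \<le> Suc D" for j using that by auto
  then have hi: "sum A {j..D} = \<alpha> j" "sum B {j..D} = \<beta> j" if "j \<le> Suc D" for j
    using that full lo[of j] sum.union_disjoint[of "{..<j}" "{j..D}" A] sum.union_disjoint[of "{..<j}" "{j..D}" B]
    by auto
  have un: "sum p (Q \<union> R) = sum p Q + sum p R" if "Q \<subseteq> N" "R \<subseteq> N" "Q \<inter> R = {}" for Q R
    using that I finite_subset[of _ N] by (intro sum.union_disjoint) (auto simp: N_def)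
  show "sum p N = 1" unfolding N_def prod by (simp add: I full)
  have "{n\<in>N. v \<in> fst n} = ?J \<times> {..D} \<times> {..D}" by (auto simp: N_def)
  then show "sum p {n\<in>N. v \<in> fst n} = \<kappa>" by (simp only: prod v full)
  assume j: "j \<le> D"
  have "{n\<in>N. shell_member True (2 * j) v n} = I \<times> {..D} \<times> {j..D} \<union> ?J \<times> {..D} \<times> {..<j}"
    using j by (auto simp: N_def shell_member_def)
  moreover have "sum p \<dots> = sum p (I \<times> {..D} \<times> {j..D}) + sum p (?J \<times> {..D} \<times> {..<j})"
    using j by (intro un) (auto simp: N_def)
  ultimately show "sum p {n\<in>N. shell_member True (2 * j) v n} = \<beta> j + \<kappa> * (1 - \<beta> j)"
    using j by (simp only: prod v full hi lo I le_SucI mult_1_left mult_1_right)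
  have "{n\<in>N. shell_member True (2 * j + 1) v n} = ?J \<times> {..D} \<times> {..<j}"
    using j by (auto simp: N_def shell_member_def)
  then show "sum p {n\<in>N. shell_member True (2 * j + 1) v n} = \<kappa> * (1 - \<beta> j)"
    by (simp only: prod v full lo mult_1_left mult_1_right)
  have "{n\<in>N. shell_member False (2 * j) v n} = ?J \<times> {..<j} \<times> {..D}"
    using j by (auto simp: N_def shell_member_def)
  then show "sum p {n\<in>N. shell_member False (2 * j) v n} = \<kappa> * (1 - \<alpha> j)"
    by (simp only: prod v full lo mult_1_left mult_1_right)
  have "{n\<in>N. shell_member False (2 * j + 1) v n} = I \<times> {Suc j..D} \<times> {..D} \<union> ?J \<times> {..<Suc j} \<times> {..D}"
    using j by (auto simp: N_def shell_member_def)
  moreover have "sum p \<dots> = sum p (I \<times> {Suc j..D} \<times> {..D}) + sum p (?J \<times> {..<Suc j} \<times> {..D})"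
    using j by (intro un) (auto simp: N_def)
  ultimately show "sum p {n\<in>N. shell_member False (2 * j + 1) v n} = \<alpha> (Suc j) + \<kappa> * (1 - \<alpha> (Suc j))"
    using j by (simp only: prod v full hi lo I Suc_le_mono mult_1_left mult_1_right)
qed

theorem mainTheorem18:
  fixes d :: nat and k \<epsilon> :: real and V W :: "'a set" and E :: "'a \<Rightarrow> 'a \<Rightarrow> bool"
    and f :: "'a \<Rightarrow> real set"
  assumes "d \<ge> 7" and "d mod 4 = 3"
    and "k \<in> \<rat>" and "2 \<le> k" and "k < 2 + 1 / (2 * real (d div 4))"
    and "\<epsilon> > 0"
    and "\<epsilon> + \<epsilon> * k * (\<Sum>j<d div 4. (k - 1) ^ (2 * j + 1)) \<ge> 1"
    and "simple_graph V E" and "frac_colorable V E k"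
    and "W \<subseteq> V" and "\<forall>u\<in>W. \<forall>v\<in>W. u \<noteq> v \<longrightarrow> dist_ge E d u v"
    and "frac_precoloring W (k + \<epsilon>) f"
  shows "precoloring_extends V E (k + \<epsilon>) W f"
proof -
  define D where "D = d div 4"
  define m where "m = k + \<epsilon>"
  note k = \<open>2 \<le> k\<close> and e = \<open>\<epsilon> > 0\<close> and G = \<open>simple_graph V E\<close> and WV = \<open>W \<subseteq> V\<close>
  have dD: "d = 4 * D + 3" using \<open>d mod 4 = 3\<close> by (simp add: D_def) presburger
  have m1: "m > 1" "m > 0" using k e by (auto simp: m_def)
  have sym: "E v u" if "E u v" for u v using G that by (auto simp: simple_graph_def)
  have finW: "finite W" using G WV finite_subset by (auto simp: simple_graph_def)
  have fW: "unit_color_set m (f w)" if "w \<in> W" for w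
    using assms(12) that by (auto simp: frac_precoloring_def m_def)
  obtain \<phi> where \<phi>: "frac_coloring V E k \<phi>" using \<open>frac_colorable V E k\<close> by (auto simp: frac_colorable_def)
  have odd_free: "\<not> (E ^^ (2 * i + 1)) w w" if "w \<in> W" "i \<le> 2 * D" for w i
    using frac_coloring_no_short_odd_closed_walk[OF G \<phi> _ k, of w "2 * D" i] that WV assms(5) by (auto simp: D_def)

  \<comment> \<open>Distribution of the labels \<open>(X, s, r)\<close>\<close>
  have "0 < k" using k by simp
  obtain I :: "'a set set" and q where finI: "finite I"
    and ind: "\<And>X u v. X \<in> I \<Longrightarrow> u \<in> X \<Longrightarrow> v \<in> X \<Longrightarrow> \<not> E u v"
    and q0: "\<And>X. 0 \<le> q X" and q1: "sum q I = 1"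
    and qv: "\<And>v. v \<in> V \<Longrightarrow> sum q {X\<in>I. v \<in> X} = 1 / k"
    by (rule frac_coloring_distribution[OF G \<phi> \<open>0 < k\<close>]) (rule that)
  obtain b where b: "b 0 = 1" "\<And>j. 0 \<le> b j" "\<And>j. b (Suc j) \<le> b j" "b D \<le> \<epsilon>"
    "\<And>j. j < D \<Longrightarrow> b j \<le> \<epsilon> + (k - 1) * (\<epsilon> + (k - 1) * b (Suc j))"
    by (rule threshold_sequence[OF k e assms(7)[folded D_def]]) (rule that)
  define \<beta> where "\<beta> j = (if j \<le> D then b j else 0)" for j
  \<comment> \<open>The denominator is the measure of the colors outside \<open>f w\<close>; the
    numerator is chosen so that even layers receive measure exactly one. As \<open>b 0 = 1\<close>,
    the quotient at \<open>0\<close> is \<open>1\<close>.\<close>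
  define \<alpha> where "\<alpha> j = (if j \<le> D then (\<epsilon> + (k - 1) * b j) / (m - 1) else 0)" for j
  have \<beta>: "\<beta> 0 = 1" "\<beta> (Suc D) = 0" "\<And>j. \<beta> (Suc j) \<le> \<beta> j" using b by (auto simp: \<beta>_def)
  have \<alpha>: "\<alpha> 0 = 1" "\<alpha> (Suc D) = 0" using m1 b by (auto simp: \<alpha>_def m_def)
  have \<alpha>dec: "\<alpha> (Suc j) \<le> \<alpha> j" for j
    using m1 b k e by (auto simp: \<alpha>_def intro!: divide_right_mono mult_left_mono)
  define p where "p = (\<lambda>(X, s, r). q X * ((\<alpha> s - \<alpha> (Suc s)) * (\<beta> r - \<beta> (Suc r))))"
  define N where "N = I \<times> {..D} \<times> {..D}"
  have p0: "0 \<le> p n" for n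
    using q0 \<alpha>dec \<beta> by (auto simp: p_def split_def)
  have finN: "finite N" using finI by (simp add: N_def)
  note weights = shell_member_weights[OF finI q1 _ \<alpha> \<beta>(1,2), folded p_def N_def]

  \<comment> \<open>Labelling of the color interval\<close>
  define B where "B = {0..<m}"
  have B: "B \<in> lmeasurable" unfolding B_def by (rule bounded_set_imp_lmeasurable) auto
  \<comment> \<open>\<open>UNIV\<close> serves the vertices far from \<open>W\<close>; near
    \<open>w\<close> the colors inside and outside \<open>f w\<close> are treated
    separately.\<close>
  define F where "F = {UNIV} \<union> f ` W \<union> (\<lambda>w. - f w) ` W"
  have F: "finite F" "F \<subseteq> sets lebesgue"
    using finW fW by (auto simp: F_def unit_color_set_def Compl_eq_Diff_UNIV intro!: sets.Diff)
  have sump: "sum p N = 1" by (rule weights(1)[OF refl])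
  have "B \<in> sets lebesgue" "B \<subseteq> {0..m}" using B by (auto simp: B_def)
  from lebesgue_independent_labelling[OF F this finN p0 sump]
  obtain g where g: "\<forall>x. g x \<in> N" "\<forall>n\<in>N. {x\<in>B. g x = n} \<in> sets lebesgue \<and>
    measure lebesgue {x\<in>B. g x = n} = p n * measure lebesgue B \<and>
    (\<forall>T\<in>F. measure lebesgue {x\<in>B \<inter> T. g x = n} = p n * measure lebesgue (B \<inter> T))"
    by (elim exE conjE) (rule that)
  have gN: "\<And>x. g x \<in> N" and gm: "\<And>n. n \<in> N \<Longrightarrow> {x\<in>B. g x = n} \<in> sets lebesgue"
    and gp: "\<And>n T. n \<in> N \<Longrightarrow> T \<in> F \<Longrightarrow> measure lebesgue {x\<in>B \<inter> T. g x = n} = p n * measure lebesgue (B \<inter> T)"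
    using g by (blast, blast, blast)
  have event: "{x\<in>B \<inter> T. P (g x)} \<in> lmeasurable"
    "measure lebesgue {x\<in>B \<inter> T. P (g x)} = measure lebesgue (B \<inter> T) * sum p {n\<in>N. P n}"
    if T: "T \<in> F" for T P
  proof -
    have T': "T \<in> sets lebesgue" using T F by auto
    have "{x\<in>B \<inter> T. P (g x)} \<in> sets lebesgue"
      by (rule measure_label_event(1)[where N = N and p = p]) (use B T' finN gN gm gp T in auto)
    then show "{x\<in>B \<inter> T. P (g x)} \<in> lmeasurable" by (intro fmeasurableI2[OF B]) auto
    show "measure lebesgue {x\<in>B \<inter> T. P (g x)} = measure lebesgue (B \<inter> T) * sum p {n\<in>N. P n}"
      by (rule measure_label_event(2)) (use B T' finN gN gm gp[OF _ T] in auto)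
  qed

  \<comment> \<open>Distance layers around \<open>W\<close>\<close>
  define near where "near v w l \<longleftrightarrow> w \<in> W \<and> l \<le> 2 * D + 1 \<and> (E ^^ l) w v \<and> (\<forall>i<l. \<not> (E ^^ i) w v)" for v w l
  have near_unique: "w = w' \<and> l = l'" if "near v w l" "near v w' l'" for v w w' l l'
  proof -
    have "(E ^^ (l + l')) w w'"
    proof (rule relpowp_trans)
      show "(E ^^ l) w v" using that by (simp add: near_def)
      show "(E ^^ l') v w'" by (rule relpowp_sym[OF sym]) (use that in \<open>auto simp: near_def\<close>)
    qed
    \<comment> \<open>Two radii sum to at most \<open>4 * D + 2\<close>, one less than
      \<open>d\<close>.\<close>
    moreover have "l + l' < d" using that dD by (simp add: near_def)
    ultimately have "w = w'"
      using assms(11) that by (auto simp: dist_ge_def walk_len_eq_relpowp near_def)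
    moreover have "\<not> l < l'" "\<not> l' < l" using that \<open>w = w'\<close> by (auto simp: near_def)
    ultimately show ?thesis by simp
  qed
  have near_exists: "\<exists>l'\<le>l. near v w l'" if "w \<in> W" "(E ^^ l) w v" "l \<le> 2 * D + 1" for v w l
  proof -
    define i where "i = (LEAST i. (E ^^ i) w v)"
    have "(E ^^ i) w v" unfolding i_def using that(2) by (rule LeastI)
    moreover have "i \<le> l" unfolding i_def using that(2) by (rule Least_le)
    moreover have "\<not> (E ^^ j) w v" if "j < i" for j using that unfolding i_def by (rule not_less_Least)
    ultimately show ?thesis using that by (auto simp: near_def)
  qed

  \<comment> \<open>The colors offered to \<open>v\<close>; the final coloring picks subsets of
    measure one.\<close>
  define C where "C v = {x\<in>B. (\<forall>w l. near v w l \<longrightarrow> shell_member (x \<in> f w) l v (g x))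
    \<and> ((\<nexists>w l. near v w l) \<longrightarrow> v \<in> fst (g x))}" for v

  \<comment> \<open>Disjointness along edges\<close>
  have in_label: "u \<in> fst (g x)" if E: "E u v" and x: "x \<in> C u" "x \<in> C v" for u v x
  proof (rule ccontr)
    assume nu: "u \<notin> fst (g x)"
    obtain X s r where g: "g x = (X, s, r)" by (cases "g x")
    with gN[of x] have sr: "s \<le> D" "r \<le> D" by (auto simp: N_def)
    obtain w l where w: "near u w l" using nu x by (auto simp: C_def)
    then have "shell_member (x \<in> f w) l u (g x)" using x by (auto simp: C_def)
    with nu g have l: "if x \<in> f w then even l \<and> l \<le> 2 * r else odd l \<and> l < 2 * s"
      by (auto simp: shell_member_def split: if_splits)
    \<comment> \<open>As \<open>u\<close> is not in the label's set, it lies in a layer filled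
      regardless of \<open>X\<close>. Such layers stop at \<open>2 * D\<close>, so the neighbor
      \<open>v\<close> still belongs to the ball around the same \<open>w\<close>.\<close>
    then have lD: "l \<le> 2 * D" using sr by (auto split: if_splits)
    have wu: "w \<in> W" "(E ^^ l) w u" using w by (auto simp: near_def)
    then have wv: "(E ^^ Suc l) w v" using E by auto
    obtain l' where l': "l' \<le> Suc l" "near v w l'" using near_exists[OF wu(1) wv] lD by auto
    \<comment> \<open>Equal parities would force \<open>l' \<le> l\<close> and close up an odd walk
      at \<open>w\<close> of length \<open>l + l' + 1 \<le> 4 * D + 1\<close>.\<close>
    have "odd (l + l')"
    proof
      assume ev: "even (l + l')"
      have "(E ^^ (Suc l + l')) w w"
      proof (rule relpowp_trans[OF wv])
        show "(E ^^ l') v w" by (rule relpowp_sym[OF sym]) (use l'(2) in \<open>auto simp: near_def\<close>)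
      qed
      moreover have "l' \<le> l" using l'(1) ev by (cases "l' = Suc l") auto
      moreover obtain i where "l + l' = 2 * i" using ev by blast
      ultimately show False using odd_free[OF wu(1), of i] lD by auto
    qed
    moreover have "shell_member (x \<in> f w) l' v (g x)" using x l' by (auto simp: C_def)
    \<comment> \<open>Layer \<open>l'\<close> has the parity that is not filled, and
      \<open>l' \<le> Suc l\<close> lies before the first layer that follows \<open>X\<close>: the
      empty layer \<open>2 * r + 1\<close> or \<open>2 * s\<close> separates the two
      regimes.\<close>
    ultimately show False using l l'(1) g by (cases "x \<in> f w") (auto simp: shell_member_def)
  qed
  have C_disj: "C u \<inter> C v = {}" if "E u v" for u v
  proof (rule ccontr)
    assume "C u \<inter> C v \<noteq> {}"
    then obtain x where x: "x \<in> C u" "x \<in> C v" by auto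
    have "u \<in> fst (g x)" "v \<in> fst (g x)" using in_label[OF that x] in_label[OF sym[OF that] x(2,1)] by simp_all
    moreover have "fst (g x) \<in> I" using gN[of x] by (auto simp: N_def)
    ultimately show False using ind that by blast
  qed

  \<comment> \<open>Measure of the offered sets\<close>
  have C_measure: "C v \<in> lmeasurable \<and> 1 \<le> measure lebesgue (C v)" if v: "v \<in> V" for v
  proof (cases "\<exists>w l. near v w l")
    case False
    then have "C v = {x\<in>B \<inter> UNIV. v \<in> fst (g x)}" by (auto simp: C_def)
    moreover have "UNIV \<in> F" by (simp add: F_def)
    moreover have "measure lebesgue B = m" using m1 by (simp add: B_def)
    ultimately show ?thesis
      using event[of UNIV "\<lambda>n. v \<in> fst n"] weights(2)[OF qv[OF v]] k e by (simp add: m_def)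
  next
    case True
    then obtain w l where w: "near v w l" by blast
    then have wW: "w \<in> W" by (simp add: near_def)
    have TF: "f w \<in> F" "- f w \<in> F" using wW by (auto simp: F_def)
    have Bf: "B \<inter> f w = f w" using fW[OF wW] by (auto simp: unit_color_set_def B_def)
    have meas: "measure lebesgue (B \<inter> f w) = 1"
      using unit_color_set_lmeasurable(2)[OF fW[OF wW]] by (simp add: Bf)
    have "measure lebesgue ((B \<inter> f w) \<union> (B \<inter> - f w)) = measure lebesgue (B \<inter> f w) + measure lebesgue (B \<inter> - f w)"
      using B TF F by (intro measure_Un_disjoint fmeasurable_Int_fmeasurable) auto
    moreover have "(B \<inter> f w) \<union> (B \<inter> - f w) = B" by auto
    ultimately have meas': "measure lebesgue (B \<inter> - f w) = m - 1" using meas m1 by (simp add: B_def)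
    have "near v w' l' \<longleftrightarrow> w' = w \<and> l' = l" for w' l' using w near_unique by metis
    then have "C v = {x\<in>B. shell_member (x \<in> f w) l v (g x)}" by (simp add: C_def)
    then have Ceq: "C v = {x\<in>B \<inter> f w. shell_member True l v (g x)} \<union> {x\<in>B \<inter> - f w. shell_member False l v (g x)}"
      by (simp only: set_eq_iff Un_iff mem_Collect_eq Int_iff Compl_iff) metis
    have "measure lebesgue (C v) = measure lebesgue {x\<in>B \<inter> f w. shell_member True l v (g x)}
      + measure lebesgue {x\<in>B \<inter> - f w. shell_member False l v (g x)}"
      unfolding Ceq by (intro measure_Un_disjoint event TF) auto
    then have mC: "measure lebesgue (C v) = sum p {n\<in>N. shell_member True l v n}
      + (m - 1) * sum p {n\<in>N. shell_member False l v n}"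
      by (simp only: event(2)[OF TF(1)] event(2)[OF TF(2)] meas meas')
    define \<kappa> where "\<kappa> = 1 / k"
    have \<kappa>: "\<kappa> * k = 1" "0 < \<kappa>" using \<open>0 < k\<close> by (simp_all add: \<kappa>_def)
    note wt = weights[OF qv[OF v], folded \<kappa>_def]
    have "1 \<le> measure lebesgue (C v)"
    proof (cases "even l")
      case True
      then obtain j where j: "l = 2 * j" by (elim evenE)
      then have jD: "j \<le> D" using w by (simp add: near_def)
      have a: "(m - 1) * \<alpha> j = \<epsilon> + (k - 1) * b j" using m1 jD by (simp add: \<alpha>_def)
      have "measure lebesgue (C v) = b j + \<kappa> * (1 - b j) + (m - 1) * (\<kappa> * (1 - \<alpha> j))"
        unfolding mC j wt(3)[OF jD] wt(5)[OF jD] using jD by (simp add: \<beta>_def)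
      also have "\<dots> = b j + \<kappa> * (m - b j - (m - 1) * \<alpha> j)" by (simp add: algebra_simps)
      also have "\<dots> = b j + (\<kappa> * k) * (1 - b j)" unfolding a by (simp add: m_def algebra_simps)
      finally show ?thesis unfolding \<kappa> by simp
    next
      case False
      then obtain j where j: "l = 2 * j + 1" by (elim oddE)
      then have jD: "j \<le> D" using w by (simp add: near_def)
      define a where "a = (m - 1) * \<alpha> (Suc j)"
      \<comment> \<open>In the outermost layer \<open>j = D\<close> the tail
        \<open>\<alpha> (Suc D)\<close> vanishes, and \<open>b D \<le> \<epsilon>\<close> replaces
        the recursion.\<close>
      have a: "b j \<le> \<epsilon> + (k - 1) * a"
      proof (cases "j = D")
        case True
        then show ?thesis using b(4) by (simp add: a_def \<alpha>)
      next
        case False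
        then show ?thesis using m1 jD b(5)[of j] by (simp add: \<alpha>_def a_def)
      qed
      have "measure lebesgue (C v) = \<kappa> * (1 - b j) + (m - 1) * (\<alpha> (Suc j) + \<kappa> * (1 - \<alpha> (Suc j)))"
        unfolding mC j wt(4)[OF jD] wt(6)[OF jD] using jD by (simp add: \<beta>_def)
      also have "\<dots> = a + \<kappa> * (m - b j - a)" by (simp add: a_def algebra_simps)
      \<comment> \<open>Since \<open>\<kappa> * k = 1\<close>, this is \<open>1\<close> plus a
        multiple of the slack in the inequality \<open>a\<close>.\<close>
      also have "\<dots> = a + (\<kappa> * k) * (1 - a) + \<kappa> * (\<epsilon> + (k - 1) * a - b j)" by (simp add: m_def algebra_simps)
      finally show ?thesis using a \<kappa> by simp
    qed
    then show ?thesis unfolding Ceq using event(1) TF by (blast intro: fmeasurable.Un)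
  qed

  \<comment> \<open>Choice of the final color sets\<close>
  have "\<exists>A. A \<subseteq> C v \<and> unit_color_set m A \<and> (v \<in> W \<longrightarrow> A = f v)" if v: "v \<in> V" for v
  proof (cases "v \<in> W")
    case True
    then have "near v v 0" by (simp add: near_def)
    then have "w = v \<and> l = 0" if "near v w l" for w l using near_unique[OF that] by blast
    \<comment> \<open>Layer \<open>0\<close> is even and \<open>0 \<le> 2 * r\<close>, so a color in
      \<open>f v\<close> is offered to \<open>v\<close> whatever its label.\<close>
    then have "f v \<subseteq> C v"
      using fW[OF True] \<open>near v v 0\<close> by (auto simp: C_def B_def unit_color_set_def shell_member_def split_def)
    then show ?thesis using fW[OF True] by blast
  next
    case False
    have sub: "C v \<subseteq> {0..m}" by (auto simp: C_def B_def)
    have C: "C v \<in> lmeasurable" "1 \<le> measure lebesgue (C v)" using C_measure[OF v] by simp_all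
    have "\<exists>A\<subseteq>C v. A \<in> sets lebesgue \<and> measure lebesgue A = 1"
      by (rule lebesgue_subset_of_measure[OF fmeasurableD[OF C(1)] sub _ C(2)]) simp
    then obtain A where A: "A \<subseteq> C v" "A \<in> sets lebesgue" "measure lebesgue A = 1" by blast
    have "A \<in> lmeasurable" by (rule fmeasurableI2[OF C(1) A(1,2)])
    then have "emeasure lebesgue A = 1" using A(3) by (simp add: emeasure_eq_measure2)
    then show ?thesis using A False by (intro exI[of _ A]) (auto simp: unit_color_set_def C_def B_def)
  qed
  then obtain c where c: "\<And>v. v \<in> V \<Longrightarrow> c v \<subseteq> C v \<and> unit_color_set m (c v) \<and> (v \<in> W \<longrightarrow> c v = f v)"
    by metis
  have "frac_coloring V E m c" unfolding frac_coloring_def using c C_disj by blast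
  then show ?thesis unfolding precoloring_extends_def m_def[symmetric] using c WV by (intro exI[of _ c]) auto
qed

end
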